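(* Let $H\le F$ be a non-trivial subgroup with Schreier graph $X=H\backslash F$, and let $v_X=\limsup_{n\to\infty}|B_X^n|^{1/n}$ be the exponential growth rate of $X$. If $v_X<2m-1$, then the action of $H$ on $(\partial F,\mathfrak m)$ is conservative.
   Context: $F$ is the free group freely generated by a finite set $\mathcal A$ with $|\mathcal A|=m\ge 2$; $\breve{\mathcal A}=\mathcal A\sqcup\mathcal A^{-1}$. Elements $g\in F$ are identified with finite freely reduced words in $\breve{\mathcal A}$, $|g|$ is the length. $\partial F$ is the set of infinite freely reduced words with the product topology; $F$ acts on it by concatenation followed by free reduction. The uniform measure $\mathfrak m$ is the Borel probability measure on $\partial F$ for which the set of infinite words beginning with $g$ has measure $\frac1{2m(2m-1)^{|g|-1}}$ for every $g\ne e$; it is quasi-invariant under $F$. The Schreier graph $X=H\backslash F$ has the cosets $Hg$ as vertices, and for each vertex $x$ and $a\in\breve{\mathcal A}$ an edge from $x$ to $xa$; $o=H$ is the origin. $B_X^n$ is the ball of radius $n$ in $X$ centered at $o$ for the graph distance. A measure class preserving action of a countable group $G$ on a measure space is conservative if every measurable set $A$ of positive measure is recurrent, i.e. (mod 0) $A\subset\bigcup_{g\ne e}gA$. *)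

theory Defs
  imports
    "HOL-Probability.Probability"
    "HOL-Algebra.Coset"
    "Graph_Theory.Shortest_Path"
begin

section \<open>Free groups as groups of reduced words\<close>

text \<open>The alphabet is \<open>'a\<close>; the letter \<open>(a, True)\<close> stands for \<open>a\<close> and \<open>(a, False)\<close> for its
  inverse.\<close>

type_synonym 'a letter = "'a \<times> bool"

definition letter_inv :: "'a letter \<Rightarrow> 'a letter" where
  "letter_inv x = (fst x, \<not> snd x)"

definition freely_reduced :: "'a letter list \<Rightarrow> bool" where
  "freely_reduced = successively (\<lambda>x y. y \<noteq> letter_inv x)"

fun cons_reduce :: "'a letter \<Rightarrow> 'a letter list \<Rightarrow> 'a letter list" where
  "cons_reduce x [] = [x]"
| "cons_reduce x (y # w) = (if y = letter_inv x then w else x # y # w)"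

definition free_reduce :: "'a letter list \<Rightarrow> 'a letter list" where
  "free_reduce w = foldr cons_reduce w []"

definition free_group :: "'a letter list monoid" where
  "free_group = \<lparr>carrier = {w. freely_reduced w}, mult = (\<lambda>u v. free_reduce (u @ v)), one = []\<rparr>"

lemma letter_inv_letter_inv [simp]: "letter_inv (letter_inv x) = x"
  by (simp add: letter_inv_def)

lemma letter_inv_neq [simp]: "letter_inv x \<noteq> x" "x \<noteq> letter_inv x"
  by (auto simp: letter_inv_def prod_eq_iff)

lemma freely_reduced_Nil [simp]: "freely_reduced []"
  by (simp add: freely_reduced_def)

lemma freely_reduced_Cons:
  "freely_reduced (x # w) \<longleftrightarrow> (w = [] \<or> hd w \<noteq> letter_inv x) \<and> freely_reduced w"
  by (cases w) (auto simp: freely_reduced_def)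

lemma freely_reduced_cons_reduce:
  "freely_reduced w \<Longrightarrow> freely_reduced (cons_reduce x w)"
  by (cases w) (auto simp: freely_reduced_Cons)

lemma freely_reduced_foldr:
  "freely_reduced w \<Longrightarrow> freely_reduced (foldr cons_reduce u w)"
  by (induction u) (auto simp: freely_reduced_cons_reduce)

lemma free_reduce_id: "freely_reduced w \<Longrightarrow> free_reduce w = w"
proof (induction w)
  case (Cons x w)
  then show ?case by (cases w) (auto simp: free_reduce_def freely_reduced_Cons)
qed (simp add: free_reduce_def)

lemma free_reduce_append:
  "freely_reduced v \<Longrightarrow> free_reduce (u @ v) = foldr cons_reduce u v"
  using free_reduce_id[of v] by (simp add: free_reduce_def)

lemma cons_reduce_cancel:
  "freely_reduced w \<Longrightarrow> cons_reduce x (cons_reduce (letter_inv x) w) = w"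
proof (cases w)
  case (Cons y v)
  then show "freely_reduced w \<Longrightarrow> ?thesis"
    by (cases v) (auto simp: freely_reduced_Cons)
qed simp

lemma foldr_cons_reduce:
  "freely_reduced w \<Longrightarrow> foldr cons_reduce (cons_reduce x u) w = cons_reduce x (foldr cons_reduce u w)"
  by (cases u) (auto simp: cons_reduce_cancel freely_reduced_foldr)

lemma foldr_foldr_cons_reduce:
  "freely_reduced w \<Longrightarrow>
     foldr cons_reduce (foldr cons_reduce u v) w = foldr cons_reduce u (foldr cons_reduce v w)"
  by (induction u) (auto simp: foldr_cons_reduce)

lemma foldr_cons_reduce_rev:
  "freely_reduced w \<Longrightarrow> foldr cons_reduce (rev (map letter_inv u)) (foldr cons_reduce u w) = w"
proof (induction u arbitrary: w)
  case (Cons x u)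
  then show ?case
    using cons_reduce_cancel[of "foldr cons_reduce u w" "letter_inv x"]
    by (simp add: freely_reduced_foldr)
qed simp

lemma group_free_group: "group free_group"
proof (rule groupI)
  fix x :: "'a letter list" assume x: "x \<in> carrier free_group"
  let ?y = "foldr cons_reduce (rev (map letter_inv x)) []"
  have "foldr cons_reduce ?y x = foldr cons_reduce (rev (map letter_inv x)) (foldr cons_reduce x [])"
    using x free_reduce_id[of x]
    by (simp add: free_group_def foldr_foldr_cons_reduce free_reduce_def)
  then have "?y \<otimes>\<^bsub>free_group\<^esub> x = \<one>\<^bsub>free_group\<^esub>"
    using x by (simp add: free_group_def free_reduce_append foldr_cons_reduce_rev)
  moreover have "?y \<in> carrier free_group"
    by (simp add: free_group_def freely_reduced_foldr)
  ultimately show "\<exists>y\<in>carrier free_group. y \<otimes>\<^bsub>free_group\<^esub> x = \<one>\<^bsub>free_group\<^esub>"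
    by blast
qed (auto simp: free_group_def free_reduce_append freely_reduced_foldr foldr_foldr_cons_reduce
       free_reduce_id)

section \<open>The boundary, its topology, and the action of the free group\<close>

definition free_boundary :: "(nat \<Rightarrow> 'a letter) set" where
  "free_boundary = {\<xi>. \<forall>n. \<xi> (Suc n) \<noteq> letter_inv (\<xi> n)}"

definition boundary_topology :: "(nat \<Rightarrow> 'a letter) topology" where
  "boundary_topology =
     subtopology (product_topology (\<lambda>_. discrete_topology UNIV) UNIV) free_boundary"

definition boundary_cons :: "'a letter \<Rightarrow> (nat \<Rightarrow> 'a letter) \<Rightarrow> (nat \<Rightarrow> 'a letter)" where
  "boundary_cons x \<xi> = (if \<xi> 0 = letter_inv x then (\<lambda>n. \<xi> (Suc n)) else case_nat x \<xi>)"

text \<open>The free reduction of the infinite word \<open>g\<xi>\<close>: the letters of \<open>g\<close> are prepended one by one,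
  from the last to the first, each followed by a cancellation if there is one.\<close>

definition boundary_act :: "'a letter list \<Rightarrow> (nat \<Rightarrow> 'a letter) \<Rightarrow> (nat \<Rightarrow> 'a letter)" where
  "boundary_act g \<xi> = foldr boundary_cons g \<xi>"

lemma boundary_act_in_boundary:
  "\<xi> \<in> free_boundary \<Longrightarrow> boundary_act g \<xi> \<in> free_boundary"
  unfolding boundary_act_def
  by (induction g) (auto simp: free_boundary_def boundary_cons_def split: nat.splits)

lemma boundary_cons_cancel:
  assumes "\<xi> \<in> free_boundary"
  shows "boundary_cons x (boundary_cons (letter_inv x) \<xi>) = \<xi>"
proof (cases "\<xi> 0 = x")
  case True
  then have "\<xi> (Suc 0) \<noteq> letter_inv x"
    using assms by (auto simp: free_boundary_def)
  then show ?thesis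
    using True by (auto simp: boundary_cons_def fun_eq_iff split: nat.splits)
qed (simp add: boundary_cons_def)

lemma boundary_act_mult:
  assumes "g \<in> carrier free_group" "h \<in> carrier free_group" "\<xi> \<in> free_boundary"
  shows "boundary_act (g \<otimes>\<^bsub>free_group\<^esub> h) \<xi> = boundary_act g (boundary_act h \<xi>)"
proof -
  have *: "boundary_act (cons_reduce x u) \<xi> = boundary_cons x (boundary_act u \<xi>)" for x u
    using boundary_cons_cancel[OF boundary_act_in_boundary[OF assms(3)]]
    by (cases u) (auto simp: boundary_act_def)
  have "boundary_act (foldr cons_reduce u h) \<xi> = boundary_act u (boundary_act h \<xi>)" for u
    by (induction u) (auto simp: *, auto simp: boundary_act_def)
  then show ?thesis
    using assms by (simp add: free_group_def free_reduce_append)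
qed

definition boundary_cylinder :: "'a letter list \<Rightarrow> (nat \<Rightarrow> 'a letter) set" where
  "boundary_cylinder g = {\<xi> \<in> free_boundary. \<forall>i<length g. \<xi> i = g ! i}"

definition uniform_measure_on_boundary :: "(nat \<Rightarrow> 'a::finite letter) measure \<Rightarrow> bool" where
  "uniform_measure_on_boundary M \<longleftrightarrow>
     prob_space M \<and>
     space M = free_boundary \<and>
     sets M = sigma_sets free_boundary {U. openin boundary_topology U} \<and>
     (\<forall>g \<in> carrier free_group - {\<one>\<^bsub>free_group\<^esub>}. measure M (boundary_cylinder g) =
        1 / (2 * real CARD('a) * (2 * real CARD('a) - 1) ^ (length g - 1)))"

section \<open>Schreier graphs and their growth\<close>

text \<open>The arc \<open>(x, a)\<close> leads from the coset \<open>x\<close> to \<open>xa\<close>; loops and multiple arcs are allowed.\<close>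

definition schreier_graph ::
    "'a letter list set \<Rightarrow> ('a letter list set, 'a letter list set \<times> 'a letter) pre_digraph" where
  "schreier_graph H =
     \<lparr>verts = rcosets\<^bsub>free_group\<^esub> H, arcs = (rcosets\<^bsub>free_group\<^esub> H) \<times> UNIV,
      tail = fst, head = (\<lambda>(x, a). x #>\<^bsub>free_group\<^esub> [a])\<rparr>"

lemma wf_digraph_schreier_graph:
  assumes "H \<subseteq> carrier free_group"
  shows "wf_digraph (schreier_graph H)"
proof -
  interpret group free_group by (rule group_free_group)
  have "[a] \<in> carrier free_group" for a :: "'a letter"
    by (simp add: free_group_def freely_reduced_Cons)
  then show ?thesis
    using assms
    by unfold_locales (auto simp: schreier_graph_def RCOSETS_def coset_mult_assoc)
qed

definition graph_distance :: "('v, 'e) pre_digraph \<Rightarrow> 'v \<Rightarrow> 'v \<Rightarrow> ereal" where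
  "graph_distance X = wf_digraph.\<mu> X (\<lambda>_. 1)"

definition graph_ball :: "('v, 'e) pre_digraph \<Rightarrow> 'v \<Rightarrow> nat \<Rightarrow> 'v set" where
  "graph_ball X v n = {w \<in> verts X. graph_distance X v w \<le> ereal (real n)}"

definition growth_rate :: "('v, 'e) pre_digraph \<Rightarrow> 'v \<Rightarrow> ereal" where
  "growth_rate X v = limsup (\<lambda>n. ereal (root n (real (card (graph_ball X v n)))))"

section \<open>Conservative actions\<close>

definition conservative_action ::
    "('g, 'b) monoid_scheme \<Rightarrow> ('g \<Rightarrow> 'x \<Rightarrow> 'x) \<Rightarrow> 'x measure \<Rightarrow> bool" where
  "conservative_action G act M \<longleftrightarrow>
     (\<forall>A \<in> sets M. emeasure M A > 0 \<longrightarrow>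
        (AE x in M. x \<in> A \<longrightarrow> x \<in> (\<Union>g \<in> carrier G - {\<one>\<^bsub>G\<^esub>}. act g ` A)))"

end

theory Submission
  imports Defs
begin

text \<open>If the action were not conservative, there would be a set \<open>N\<close> of positive measure disjoint from
  all its translates \<open>hN\<close>, \<open>h \<in> H - {e}\<close>. Cut \<open>N\<close> into its intersections with the cylinders of the
  words \<open>g\<close> of length \<open>n\<close>. Removing the prefix \<open>g\<close> multiplies the measure on the cylinder of \<open>g\<close> by
  \<open>(2m - 1)\<^sup>n\<close> and maps \<open>N\<close> into \<open>g\<inverse>N\<close>. For distinct \<open>g\<close>, \<open>g'\<close> in one coset of \<open>H\<close> the sets \<open>g\<inverse>N\<close>
  and \<open>g'\<inverse>N\<close> are disjoint, because \<open>g'g\<inverse> \<in> H\<close>, so each coset contributes at most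
  \<open>(2m - 1)\<^sup>-\<^sup>n\<close> to the measure of \<open>N\<close>. All these cosets lie in the ball of radius \<open>n\<close>, hence
  \<open>\<mu>(N) \<le> |B\<^sub>X\<^sup>n| (2m - 1)\<^sup>-\<^sup>n\<close>, which tends to \<open>0\<close>.\<close>

section \<open>Balls in Schreier graphs\<close>

text \<open>The word \<open>w\<close> need not be reduced: walks in the graph may backtrack, and all
  of them are to be labelled by words.\<close>

definition coset_path :: "'a letter list set \<Rightarrow> 'a letter list \<Rightarrow> 'a letter list set" where
  "coset_path x w = foldl (\<lambda>y a. y #>\<^bsub>free_group\<^esub> [a]) x w"

lemma freely_reduced_free_reduce: "freely_reduced (free_reduce w)"
  by (simp add: free_reduce_def freely_reduced_foldr)

lemma singleton_in_free_group: "[a] \<in> carrier free_group"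
  by (simp add: free_group_def freely_reduced_Cons)

lemma singleton_mult_free_reduce:
  "[a] \<otimes>\<^bsub>free_group\<^esub> free_reduce w = free_reduce (a # w)"
  using free_reduce_append[OF freely_reduced_free_reduce, of "[a]" w]
  by (simp add: free_group_def free_reduce_def)

text \<open>Cancelling letters retrace an edge, so the endpoint depends only on the reduction of
  \<open>w\<close>. The induction absorbs the first letter into the starting set, hence the general
  \<open>x\<close>.\<close>

lemma coset_path_eq:
  assumes "x \<subseteq> carrier free_group"
  shows "coset_path x w = x #>\<^bsub>free_group\<^esub> free_reduce w"
  using assms
proof (induction w arbitrary: x)
  case Nil
  interpret group free_group by (rule group_free_group)
  show ?case
    using coset_mult_one[OF Nil] by (simp add: coset_path_def free_reduce_def free_group_def)
next
  case (Cons a w)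
  interpret group free_group by (rule group_free_group)
  have "coset_path x (a # w) = coset_path (x #>\<^bsub>free_group\<^esub> [a]) w"
    by (simp add: coset_path_def)
  also have "\<dots> = x #>\<^bsub>free_group\<^esub> [a] #>\<^bsub>free_group\<^esub> free_reduce w"
    using Cons.prems by (intro Cons.IH r_coset_subset_G singleton_in_free_group)
  also have "\<dots> = x #>\<^bsub>free_group\<^esub> ([a] \<otimes>\<^bsub>free_group\<^esub> free_reduce w)"
    by (rule coset_mult_assoc[OF Cons.prems singleton_in_free_group])
       (simp add: free_group_def freely_reduced_free_reduce)
  finally show ?case
    by (simp add: singleton_mult_free_reduce)
qed

lemma schreier_graph_simps:
  "verts (schreier_graph H) = rcosets\<^bsub>free_group\<^esub> H"
  "arcs (schreier_graph H) = (rcosets\<^bsub>free_group\<^esub> H) \<times> UNIV"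
  "tail (schreier_graph H) = fst"
  "head (schreier_graph H) = (\<lambda>(x, a). x #>\<^bsub>free_group\<^esub> [a])"
  by (simp_all add: schreier_graph_def)

text \<open>An arc carries its letter, so words are exactly the label sequences of walks. Together
  with \<open>awalk_imp_coset_path\<close> this turns graph distance into word length.\<close>

lemma awalk_coset_path:
  assumes "H \<subseteq> carrier free_group" "x \<in> rcosets\<^bsub>free_group\<^esub> H"
  shows "\<exists>p. pre_digraph.awalk (schreier_graph H) x p (coset_path x w) \<and> length p = length w"
  using assms(2)
proof (induction w arbitrary: x)
  case Nil
  interpret wf_digraph "schreier_graph H" by (rule wf_digraph_schreier_graph[OF assms(1)])
  show ?case
    using Nil by (simp add: coset_path_def awalk_Nil_iff schreier_graph_simps)
next
  case (Cons a w)
  interpret wf_digraph "schreier_graph H" by (rule wf_digraph_schreier_graph[OF assms(1)])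
  have arc: "(x, a) \<in> arcs (schreier_graph H)"
    using Cons.prems by (simp add: schreier_graph_def)
  then have "x #>\<^bsub>free_group\<^esub> [a] \<in> rcosets\<^bsub>free_group\<^esub> H"
    using head_in_verts[OF arc] by (simp add: schreier_graph_def)
  then obtain p where p: "awalk (x #>\<^bsub>free_group\<^esub> [a]) p (coset_path (x #>\<^bsub>free_group\<^esub> [a]) w)"
      "length p = length w"
    using Cons.IH by blast
  have "awalk x ((x, a) # p) (coset_path x (a # w))"
    using p(1) arc by (simp add: awalk_Cons_iff coset_path_def schreier_graph_simps)
  then show ?case
    using p(2) by (metis length_Cons)
qed

lemma awalk_imp_coset_path:
  assumes "H \<subseteq> carrier free_group" "pre_digraph.awalk (schreier_graph H) x p y"
  shows "\<exists>w. y = coset_path x w \<and> length w = length p"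
  using assms(2)
proof (induction p arbitrary: x)
  case Nil
  interpret wf_digraph "schreier_graph H" by (rule wf_digraph_schreier_graph[OF assms(1)])
  show ?case
    using Nil by (simp add: coset_path_def awalk_Nil_iff)
next
  case (Cons e p)
  interpret wf_digraph "schreier_graph H" by (rule wf_digraph_schreier_graph[OF assms(1)])
  obtain z a where e: "e = (z, a)" by (cases e)
  have "z = x" "awalk (x #>\<^bsub>free_group\<^esub> [a]) p y"
    using Cons.prems by (simp_all add: awalk_Cons_iff e schreier_graph_simps)
  then obtain w where "y = coset_path (x #>\<^bsub>free_group\<^esub> [a]) w" "length w = length p"
    using Cons.IH by blast
  then have "y = coset_path x (a # w) \<and> length (a # w) = length (e # p)"
    by (simp add: coset_path_def)
  then show ?case by blast
qed

lemma (in wf_digraph) awalk_cost_unit: "awalk_cost (\<lambda>_. 1) p = real (length p)"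
  by (induction p) simp_all

lemma subgroup_in_rcosets:
  assumes "subgroup H free_group"
  shows "H \<in> rcosets\<^bsub>free_group\<^esub> H"
  by (rule subgroup.subgroup_in_rcosets[OF assms group_free_group])

lemma graph_ball_schreier_graph:
  assumes "subgroup H free_group"
  shows "graph_ball (schreier_graph H) H n = coset_path H ` {w. length w \<le> n}"
proof -
  have sub: "H \<subseteq> carrier free_group" using assms by (rule subgroup.subset)
  interpret wf_digraph "schreier_graph H" by (rule wf_digraph_schreier_graph[OF sub])
  show ?thesis
  proof (intro equalityI subsetI)
    fix x assume "x \<in> graph_ball (schreier_graph H) H n"
    then have "\<mu> (\<lambda>_. 1) H x \<le> ereal (real n)"
      by (simp add: graph_ball_def graph_distance_def)
    \<comment> \<open>The distance is an infimum, so a walk can be extracted only from a strict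
      bound. Nothing is lost: lengths are integers, and a length below \<open>n + 1\<close> is at
      most \<open>n\<close>.\<close>
    also have "\<dots> < ereal (real n + 1)" by simp
    finally obtain p where p: "awalk H p x" "awalk_cost (\<lambda>_. 1) p < real n + 1"
      unfolding \<mu>_def INF_less_iff by auto
    obtain w where w: "x = coset_path H w" "length w = length p"
      using awalk_imp_coset_path[OF sub p(1)] by blast
    moreover have "length w \<le> n"
      using p(2) w(2) by (simp add: awalk_cost_unit)
    ultimately show "x \<in> coset_path H ` {w. length w \<le> n}" by blast
  next
    fix x assume "x \<in> coset_path H ` {w. length w \<le> n}"
    then obtain w where w: "x = coset_path H w" "length w \<le> n" by blast
    obtain p where p: "awalk H p x" "length p = length w"
      using awalk_coset_path[OF sub subgroup_in_rcosets[OF assms], of w] w(1) by blast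
    have "\<mu> (\<lambda>_. 1) H x \<le> ereal (awalk_cost (\<lambda>_. 1) p)"
      by (rule min_cost_le_walk_cost[OF p(1)])
    also have "\<dots> \<le> ereal (real n)"
      using p(2) w(2) by (simp add: awalk_cost_unit)
    finally show "x \<in> graph_ball (schreier_graph H) H n"
      using awalk_last_in_verts[OF p(1)] by (simp add: graph_ball_def graph_distance_def)
  qed
qed

lemma card_cosets_of_length_le_graph_ball:
  fixes H :: "'a::finite letter list set"
  assumes "subgroup H free_group"
  shows "card ((\<lambda>g. H #>\<^bsub>free_group\<^esub> g) ` {g \<in> carrier free_group. length g = n})
           \<le> card (graph_ball (schreier_graph H) H n)"
proof (rule card_mono)
  \<comment> \<open>Monotonicity of \<open>card\<close> needs a finite ball; the finite alphabet
    provides it.\<close>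
  have "finite {w :: 'a letter list. length w \<le> n}"
    using finite_lists_length_le[of "UNIV :: 'a letter set" n] by simp
  then show "finite (graph_ball (schreier_graph H) H n)"
    unfolding graph_ball_schreier_graph[OF assms] by (rule finite_imageI)
  show "(\<lambda>g. H #>\<^bsub>free_group\<^esub> g) ` {g \<in> carrier free_group. length g = n}
      \<subseteq> graph_ball (schreier_graph H) H n"
    unfolding graph_ball_schreier_graph[OF assms]
    using coset_path_eq[OF subgroup.subset[OF assms]]
    by (force simp: free_group_def free_reduce_id)
qed

section \<open>Measurability on the boundary\<close>

lemma boundary_cylinder_eq_Int:
  "boundary_cylinder g = free_boundary \<inter> (\<Inter>i<length g. {\<xi>. \<xi> i = g ! i})"
  by (auto simp: boundary_cylinder_def)

lemma openin_boundary_cylinder: "openin boundary_topology (boundary_cylinder g)"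
proof -
  let ?P = "product_topology (\<lambda>_::nat. discrete_topology (UNIV :: 'a letter set)) UNIV"
  have cyl: "openin ?P {\<xi>. \<xi> i = a}" for i and a :: "'a letter"
  proof -
    have "continuous_map ?P (discrete_topology UNIV) (\<lambda>\<xi>. \<xi> i)"
      by (rule continuous_map_product_projection[of i UNIV "\<lambda>_. discrete_topology UNIV", simplified])
    then have "openin ?P {\<xi> \<in> topspace ?P. \<xi> i \<in> {a}}"
      by (rule openin_continuous_map_preimage) simp
    then show ?thesis by (simp add: PiE_def)
  qed
  \<comment> \<open>\<open>openin_INT2\<close> needs a nonempty index set; for the empty word the
    intersection is the whole product.\<close>
  have "openin ?P (\<Inter>i<length g. {\<xi>. \<xi> i = g ! i})"
  proof (cases "g = []")
    case True
    then show ?thesis using openin_topspace[of ?P] by simp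
  next
    case False
    then show ?thesis by (intro openin_INT2) (auto simp: cyl)
  qed
  then show ?thesis
    unfolding boundary_cylinder_eq_Int boundary_topology_def openin_subtopology by blast
qed

text \<open>A basic open set of the product constrains finitely many coordinates, so a prefix of
  \<open>\<xi>\<close> reaching past all of them determines a cylinder inside it.\<close>

lemma cylinder_nbhd_of_openin_boundary:
  assumes "openin boundary_topology U" "\<xi> \<in> U"
  shows "\<exists>g. \<xi> \<in> boundary_cylinder g \<and> boundary_cylinder g \<subseteq> U"
proof -
  let ?P = "product_topology (\<lambda>_::nat. discrete_topology (UNIV :: 'a letter set)) UNIV"
  obtain T where T: "openin ?P T" "U = T \<inter> free_boundary"
    using assms(1) unfolding boundary_topology_def openin_subtopology by blast
  then obtain V where V: "finite {i. V i \<noteq> (UNIV :: 'a letter set)}" "\<xi> \<in> Pi\<^sub>E UNIV V"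
      "Pi\<^sub>E UNIV V \<subseteq> T"
    using assms(2) unfolding openin_product_topology_alt by fastforce
  obtain n where n: "\<And>i. V i \<noteq> UNIV \<Longrightarrow> i < n"
    using V(1) unfolding finite_nat_set_iff_bounded by blast
  let ?g = "map \<xi> [0..<n]"
  have "boundary_cylinder ?g \<subseteq> Pi\<^sub>E UNIV V"
  proof
    fix \<eta> assume \<eta>: "\<eta> \<in> boundary_cylinder ?g"
    have "\<eta> i \<in> V i" for i
    proof (cases "V i = UNIV")
      case False
      then have "\<eta> i = \<xi> i" using \<eta> n[of i] by (simp add: boundary_cylinder_def)
      then show ?thesis using V(2) by auto
    qed simp
    then show "\<eta> \<in> Pi\<^sub>E UNIV V" by auto
  qed
  then have "boundary_cylinder ?g \<subseteq> U"
    using V(3) T(2) by (auto simp: boundary_cylinder_def)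
  moreover have "\<xi> \<in> boundary_cylinder ?g"
    using assms(2) T(2) by (simp add: boundary_cylinder_def)
  ultimately show ?thesis by blast
qed

lemma boundary_cylinder_subset: "boundary_cylinder g \<subseteq> free_boundary"
  by (auto simp: boundary_cylinder_def)

text \<open>There are only countably many words, so every open set is a countable union of
  cylinders. Cylinders can therefore serve as generator both for measurability and for uniqueness of
  measures.\<close>

lemma sigma_sets_boundary_cylinders:
  "sigma_sets free_boundary {U. openin boundary_topology U} =
     sigma_sets free_boundary (range (boundary_cylinder :: 'a::finite letter list \<Rightarrow> _))"
proof
  let ?S = "sigma_sets free_boundary (range (boundary_cylinder :: 'a letter list \<Rightarrow> _))"
  show "sigma_sets free_boundary {U. openin boundary_topology U} \<subseteq> ?S"
  proof (rule sigma_sets_mono, rule subsetI)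
    fix U :: "(nat \<Rightarrow> 'a letter) set" assume "U \<in> {U. openin boundary_topology U}"
    then have "U = \<Union>(boundary_cylinder ` {g. boundary_cylinder g \<subseteq> U})"
      using cylinder_nbhd_of_openin_boundary[of U] by blast
    also have "\<dots> \<in> ?S"
      by (rule sigma_sets_UNION) (auto intro: countableI_type)
    finally show "U \<in> ?S" .
  qed
  show "?S \<subseteq> sigma_sets free_boundary {U. openin boundary_topology U}"
    by (rule sigma_sets_mono) (auto intro: openin_boundary_cylinder sigma_sets.Basic)
qed

lemma sets_uniform_measure:
  "uniform_measure_on_boundary M \<Longrightarrow> sets M = sigma_sets free_boundary (range boundary_cylinder)"
  by (simp add: uniform_measure_on_boundary_def sigma_sets_boundary_cylinders)

lemma space_uniform_measure: "uniform_measure_on_boundary M \<Longrightarrow> space M = free_boundary"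
  by (simp add: uniform_measure_on_boundary_def)

lemma boundary_cylinder_in_sets:
  "uniform_measure_on_boundary M \<Longrightarrow> boundary_cylinder g \<in> sets M"
  by (auto simp: sets_uniform_measure)

lemma measurable_coordinate:
  assumes "uniform_measure_on_boundary M"
  shows "(\<lambda>\<xi>. \<xi> n) \<in> measurable M (count_space UNIV)"
proof (rule measurable_count_space_eq2_countable[THEN iffD2])
  have "(\<lambda>\<xi>. \<xi> n) -` {a} \<inter> space M \<in> sets M" for a
  proof -
    let ?G = "{g. length g = Suc n \<and> g ! n = a}"
    have "(\<lambda>\<xi>. \<xi> n) -` {a} \<inter> space M = \<Union>(boundary_cylinder ` ?G)"
    proof (intro equalityI subsetI)
      fix \<xi> assume \<xi>: "\<xi> \<in> (\<lambda>\<xi>. \<xi> n) -` {a} \<inter> space M"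
      then have "map \<xi> [0..<Suc n] \<in> ?G" by (simp del: upt_Suc)
      moreover have "\<xi> \<in> boundary_cylinder (map \<xi> [0..<Suc n])"
        using \<xi> assms by (simp add: boundary_cylinder_def space_uniform_measure del: upt_Suc)
      ultimately show "\<xi> \<in> \<Union>(boundary_cylinder ` ?G)" by blast
    next
      fix \<xi> assume "\<xi> \<in> \<Union>(boundary_cylinder ` ?G)"
      then show "\<xi> \<in> (\<lambda>\<xi>. \<xi> n) -` {a} \<inter> space M"
        using assms by (auto simp: boundary_cylinder_def space_uniform_measure)
    qed
    also have "\<dots> \<in> sets M"
      by (rule sets.countable_UN') (auto intro: boundary_cylinder_in_sets assms)
    finally show ?thesis .
  qed
  then show "(\<lambda>\<xi>. \<xi> n) \<in> space M \<rightarrow> UNIV \<and> (\<forall>a\<in>UNIV. (\<lambda>\<xi>. \<xi> n) -` {a} \<inter> space M \<in> sets M)"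
    by simp
qed

text \<open>Each cylinder is cut out by finitely many conditions on single letters, so measurability
  can be tested one coordinate at a time.\<close>

lemma measurable_into_boundary:
  assumes "uniform_measure_on_boundary M"
    and "\<And>x. x \<in> space N \<Longrightarrow> f x \<in> free_boundary"
    and "\<And>n. (\<lambda>x. f x n) \<in> measurable N (count_space UNIV)"
  shows "f \<in> measurable N M"
proof (rule measurable_sigma_sets[OF sets_uniform_measure[OF assms(1)]])
  fix B assume "B \<in> range (boundary_cylinder :: 'a letter list \<Rightarrow> _)"
  then obtain g :: "'a letter list" where g: "B = boundary_cylinder g" by blast
  have [measurable]: "(\<lambda>x. f x n) \<in> measurable N (count_space UNIV)" for n
    by (rule assms(3))
  have "f -` B \<inter> space N = {x \<in> space N. \<forall>i<length g. f x i = g ! i}"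
    using assms(2) by (auto simp: g boundary_cylinder_def)
  also have "\<dots> \<in> sets N"
    by measurable
  finally show "f -` B \<inter> space N \<in> sets N" .
qed (use assms(2) boundary_cylinder_subset in auto)

section \<open>Measurability and invertibility of the action\<close>

lemma measurable_boundary_act:
  assumes "uniform_measure_on_boundary M"
  shows "boundary_act g \<in> measurable M M"
proof (induction g)
  case Nil
  show ?case using measurable_ident[of M] by (simp add: boundary_act_def id_def)
next
  case (Cons x g)
  have [measurable]: "(\<lambda>\<xi>. \<xi> n) \<in> measurable M (count_space UNIV)" for n
    by (rule measurable_coordinate[OF assms])
  have "boundary_cons x \<in> measurable M M"
  proof (rule measurable_into_boundary[OF assms])
    show "boundary_cons x \<xi> \<in> free_boundary" if "\<xi> \<in> space M" for \<xi>
      using boundary_act_in_boundary[of \<xi> "[x]"] that assms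
      by (simp add: boundary_act_def space_uniform_measure)
    show "(\<lambda>\<xi>. boundary_cons x \<xi> n) \<in> measurable M (count_space UNIV)" for n
    proof -
      have "(\<lambda>\<xi>. boundary_cons x \<xi> n) =
          (\<lambda>\<xi>. if \<xi> 0 = letter_inv x then \<xi> (Suc n) else if n = 0 then x else \<xi> (n - 1))"
        by (auto simp: boundary_cons_def fun_eq_iff split: nat.splits)
      then show ?thesis by simp
    qed
  qed
  from measurable_compose[OF Cons.IH this] show ?case
    by (simp add: boundary_act_def comp_def)
qed

lemma boundary_act_inv:
  assumes "g \<in> carrier free_group" "\<xi> \<in> free_boundary"
  shows "boundary_act (inv\<^bsub>free_group\<^esub> g) (boundary_act g \<xi>) = \<xi>"
    and "boundary_act g (boundary_act (inv\<^bsub>free_group\<^esub> g) \<xi>) = \<xi>"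
proof -
  interpret group free_group by (rule group_free_group)
  have one: "boundary_act \<one>\<^bsub>free_group\<^esub> \<xi> = \<xi>"
    by (simp add: boundary_act_def free_group_def)
  show "boundary_act (inv\<^bsub>free_group\<^esub> g) (boundary_act g \<xi>) = \<xi>"
    using boundary_act_mult[OF inv_closed[OF assms(1)] assms] assms(1) one by simp
  show "boundary_act g (boundary_act (inv\<^bsub>free_group\<^esub> g) \<xi>) = \<xi>"
    using boundary_act_mult[OF assms(1) inv_closed[OF assms(1)] assms(2)] assms(1) one by simp
qed

text \<open>The image under \<open>g\<close> is the preimage under the inverse of \<open>g\<close>,
  and preimages of measurable sets are measurable.\<close>

lemma boundary_act_image_in_sets:
  assumes "uniform_measure_on_boundary M" "g \<in> carrier free_group" "A \<in> sets M"
  shows "boundary_act g ` A \<in> sets M"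
proof -
  have A: "A \<subseteq> free_boundary"
    using sets.sets_into_space[OF assms(3)] space_uniform_measure[OF assms(1)] by simp
  have "boundary_act g ` A = boundary_act (inv\<^bsub>free_group\<^esub> g) -` A \<inter> space M"
  proof (intro equalityI subsetI)
    fix \<xi> assume "\<xi> \<in> boundary_act g ` A"
    then show "\<xi> \<in> boundary_act (inv\<^bsub>free_group\<^esub> g) -` A \<inter> space M"
      using A boundary_act_inv(1)[OF assms(2)] boundary_act_in_boundary
      by (auto simp: space_uniform_measure[OF assms(1)])
  next
    fix \<xi> assume "\<xi> \<in> boundary_act (inv\<^bsub>free_group\<^esub> g) -` A \<inter> space M"
    then have "boundary_act (inv\<^bsub>free_group\<^esub> g) \<xi> \<in> A" "\<xi> \<in> free_boundary"
      by (simp_all add: space_uniform_measure[OF assms(1)])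
    then show "\<xi> \<in> boundary_act g ` A"
      using boundary_act_inv(2)[OF assms(2)] by (metis imageI)
  qed
  then show ?thesis
    using measurable_sets[OF measurable_boundary_act[OF assms(1)] assms(3)] by simp
qed

section \<open>Scaling of the uniform measure under the shift\<close>

lemma boundary_cylinder_eq_empty:
  assumes "\<not> freely_reduced g"
  shows "boundary_cylinder g = {}"
proof -
  obtain i where "Suc i < length g" "g ! Suc i = letter_inv (g ! i)"
    using assms by (auto simp: freely_reduced_def successively_conv_nth)
  then show ?thesis
    by (auto simp: boundary_cylinder_def free_boundary_def) (metis Suc_lessD)
qed

text \<open>Two cylinders are nested or disjoint. Since cylinders are indexed by all words, reduced
  or not, the empty set is one of them too.\<close>

lemma Int_stable_boundary_cylinders: "Int_stable (range boundary_cylinder)"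
proof (rule Int_stableI)
  have prefix: "boundary_cylinder u \<inter> boundary_cylinder v \<in> range boundary_cylinder"
    if "length u \<le> length v" for u v :: "'a letter list"
  proof (cases "\<forall>i<length u. u ! i = v ! i")
    case True
    then have "boundary_cylinder u \<inter> boundary_cylinder v = boundary_cylinder v"
      using that by (auto simp: boundary_cylinder_def)
    then show ?thesis by simp
  next
    case False
    have "boundary_cylinder u \<inter> boundary_cylinder v = {}"
      using False that by (fastforce simp: boundary_cylinder_def)
    \<comment> \<open>Any letter followed by its inverse would do: no boundary point has such a
      prefix.\<close>
    also have "\<dots> = boundary_cylinder [undefined, letter_inv undefined]"
      by (rule boundary_cylinder_eq_empty[symmetric]) (simp add: freely_reduced_Cons)
    finally show ?thesis by blast
  qed
  fix A B :: "(nat \<Rightarrow> 'a letter) set"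
  assume "A \<in> range boundary_cylinder" "B \<in> range boundary_cylinder"
  then obtain u v where "A = boundary_cylinder u" "B = boundary_cylinder v" by blast
  then show "A \<inter> B \<in> range boundary_cylinder"
    using prefix[of u v] prefix[of v u] by (cases "length u \<le> length v") (auto simp: Int_commute)
qed

text \<open>On the cylinder of a word of length \<open>n\<close> this is the action of the inverse
  of that word, but the formula does not depend on the word.\<close>

definition boundary_shift :: "nat \<Rightarrow> (nat \<Rightarrow> 'a letter) \<Rightarrow> (nat \<Rightarrow> 'a letter)" where
  "boundary_shift n \<xi> = (\<lambda>i. \<xi> (n + i))"

lemma boundary_shift_in_boundary: "\<xi> \<in> free_boundary \<Longrightarrow> boundary_shift n \<xi> \<in> free_boundary"
  by (simp add: free_boundary_def boundary_shift_def)

lemma measurable_boundary_shift: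
  assumes "uniform_measure_on_boundary M"
  shows "boundary_shift n \<in> measurable M M"
proof (rule measurable_into_boundary[OF assms])
  show "(\<lambda>\<xi>. boundary_shift n \<xi> i) \<in> measurable M (count_space UNIV)" for i
    unfolding boundary_shift_def by (rule measurable_coordinate[OF assms])
qed (simp add: boundary_shift_in_boundary space_uniform_measure[OF assms])

text \<open>Putting back the deleted prefix causes no cancellation, because \<open>\<xi>\<close> is
  reduced.\<close>

lemma boundary_act_shift:
  "\<xi> \<in> boundary_cylinder g \<Longrightarrow> boundary_act g (boundary_shift (length g) \<xi>) = \<xi>"
proof (induction g arbitrary: \<xi>)
  case Nil
  then show ?case by (simp add: boundary_act_def boundary_shift_def)
next
  case (Cons x g)
  let ?\<eta> = "boundary_shift 1 \<xi>"
  have \<xi>: "\<xi> \<in> free_boundary" "\<xi> 0 = x" "\<forall>i<length g. \<xi> (Suc i) = g ! i"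
    using Cons.prems by (auto simp: boundary_cylinder_def)
  have "?\<eta> \<in> boundary_cylinder g"
    using \<xi> boundary_shift_in_boundary[of \<xi> 1] by (auto simp: boundary_cylinder_def boundary_shift_def)
  then have "boundary_act g (boundary_shift (length g) ?\<eta>) = ?\<eta>"
    by (rule Cons.IH)
  moreover have "boundary_shift (length g) ?\<eta> = boundary_shift (length (x # g)) \<xi>"
    by (simp add: boundary_shift_def)
  moreover have "boundary_cons x ?\<eta> = \<xi>"
    using \<xi> by (auto simp: boundary_cons_def boundary_shift_def free_boundary_def fun_eq_iff
        split: nat.splits)
  ultimately show ?case
    by (simp add: boundary_act_def)
qed

text \<open>This covers words \<open>g @ w\<close> with a cancellation at the junction; both sides
  are then empty.\<close>

lemma boundary_cylinder_append:
  "boundary_cylinder g \<inter> boundary_shift (length g) -` boundary_cylinder w = boundary_cylinder (g @ w)"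
proof (intro equalityI subsetI)
  fix \<xi> assume "\<xi> \<in> boundary_cylinder g \<inter> boundary_shift (length g) -` boundary_cylinder w"
  then have \<xi>: "\<xi> \<in> free_boundary" "\<And>i. i < length g \<Longrightarrow> \<xi> i = g ! i"
      "\<And>i. i < length w \<Longrightarrow> \<xi> (length g + i) = w ! i"
    by (auto simp: boundary_cylinder_def boundary_shift_def)
  have "\<xi> i = (g @ w) ! i" if "i < length (g @ w)" for i
    using \<xi>(2)[of i] \<xi>(3)[of "i - length g"] that by (auto simp: nth_append)
  then show "\<xi> \<in> boundary_cylinder (g @ w)"
    using \<xi>(1) by (simp add: boundary_cylinder_def)
next
  fix \<xi> assume \<xi>: "\<xi> \<in> boundary_cylinder (g @ w)"
  then have "\<xi> i = (g @ w) ! i" if "i < length g + length w" for i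
    using that by (simp add: boundary_cylinder_def)
  from this this[of "length g + _"]
  show "\<xi> \<in> boundary_cylinder g \<inter> boundary_shift (length g) -` boundary_cylinder w"
    using \<xi> boundary_shift_in_boundary[of \<xi>]
    by (simp add: boundary_cylinder_def nth_append) (simp add: boundary_shift_def)
qed

text \<open>Prefixing \<open>g\<close> without cancellation divides the measure of a cylinder by
  \<open>(2m - 1) ^ length g\<close>. Both sides are finite measures in \<open>E\<close>, so
  agreement on the intersection-stable family of cylinders suffices. The condition on
  \<open>\<xi> 0\<close> singles out the words that can follow \<open>g\<close>.\<close>

lemma measure_cylinder_Int_shift:
  fixes M :: "(nat \<Rightarrow> 'a::finite letter) measure"
  assumes M: "uniform_measure_on_boundary M" and g: "freely_reduced g" "g \<noteq> []"
    and E: "E \<in> sets M"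
  shows "measure M (boundary_cylinder g \<inter> boundary_shift (length g) -` E) =
    measure M {\<xi> \<in> E. \<xi> 0 \<noteq> letter_inv (last g)} / (2 * real CARD('a) - 1) ^ length g"
proof -
  interpret prob_space M using M by (simp add: uniform_measure_on_boundary_def)
  define m where "m = real CARD('a)"
  define q where "q = 2 * m - 1"
  have m: "m \<ge> 1" by (simp add: m_def Suc_le_eq)
  then have q: "q > 0" by (simp add: q_def)
  define n where "n = length g"
  let ?C = "boundary_cylinder g"
  define D where "D = {\<xi> \<in> free_boundary. \<xi> 0 \<noteq> letter_inv (last g)}"
  have sp: "space M = free_boundary" by (rule space_uniform_measure[OF M])
  have cyl: "boundary_cylinder w \<in> sets M" for w :: "'a letter list"
    by (rule boundary_cylinder_in_sets[OF M])
  have D_eq: "D = space M - boundary_cylinder [letter_inv (last g)]"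
    by (auto simp: D_def sp boundary_cylinder_def)
  then have D: "D \<in> sets M" using cyl by auto
  have cyl_measure: "measure M (boundary_cylinder w) = 1 / (2 * m * q ^ (length w - 1))"
    if "freely_reduced w" "w \<noteq> []" for w :: "'a letter list"
    using M that by (simp add: uniform_measure_on_boundary_def free_group_def m_def q_def)
  have shift: "boundary_shift n \<in> measurable (density M (indicator ?C)) M"
    using measurable_boundary_shift[OF M] by simp
  \<comment> \<open>\<open>?P\<close> pushes the restriction of \<open>M\<close> to the cylinder of
    \<open>g\<close> forward by the shift; \<open>?Q\<close> is the restriction of \<open>M\<close>
    to \<open>D\<close>, rescaled.\<close>
  let ?P = "distr (density M (indicator ?C)) M (boundary_shift n)"
  let ?Q = "scale_measure (ennreal (1 / q ^ n)) (density M (indicator D))"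
  have P: "emeasure ?P X = ennreal (measure M (?C \<inter> boundary_shift n -` X))" if "X \<in> sets M" for X
  proof -
    have pre: "boundary_shift n -` X \<inter> space M \<in> sets M"
      using measurable_boundary_shift[OF M] that by (rule measurable_sets)
    have "emeasure ?P X = emeasure M (?C \<inter> (boundary_shift n -` X \<inter> space M))"
      using emeasure_restricted[OF cyl pre] by (subst emeasure_distr[OF shift that]) simp
    also have "?C \<inter> (boundary_shift n -` X \<inter> space M) = ?C \<inter> boundary_shift n -` X"
      using boundary_cylinder_subset by (auto simp: sp)
    finally show ?thesis by (simp add: emeasure_eq_measure)
  qed
  have Q: "emeasure ?Q X = ennreal (measure M (D \<inter> X) / q ^ n)" if "X \<in> sets M" for X
    using emeasure_restricted[OF D that] q
    by (simp add: emeasure_eq_measure flip: ennreal_mult')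
  have "?P = ?Q"
  proof (rule measure_eqI_generator_eq[OF Int_stable_boundary_cylinders])
    show "range boundary_cylinder \<subseteq> Pow (free_boundary :: (nat \<Rightarrow> 'a letter) set)"
      using boundary_cylinder_subset by blast
    fix X :: "(nat \<Rightarrow> 'a letter) set" assume "X \<in> range boundary_cylinder"
    then obtain w :: "'a letter list" where X: "X = boundary_cylinder w" by blast
    \<comment> \<open>The formula for cylinder measures excludes the empty word, so total masses are
      compared separately: \<open>D\<close> omits one of \<open>2m\<close> equally likely first
      letters and has measure \<open>q / (2m)\<close>.\<close>
    have "measure M (?C \<inter> boundary_shift n -` X) = measure M (D \<inter> X) / q ^ n"
    proof (cases "w = []")
      case True
      have "X = space M" by (auto simp: X True boundary_cylinder_def sp)
      moreover have "measure M D = q / (2 * m)"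
      proof -
        have "measure M D = 1 - measure M (boundary_cylinder [letter_inv (last g)])"
          unfolding D_eq by (rule prob_compl[OF cyl])
        also have "\<dots> = 1 - 1 / (2 * m)"
          by (subst cyl_measure) (simp_all add: freely_reduced_Cons)
        also have "\<dots> = q / (2 * m)"
          using m by (simp add: q_def field_simps)
        finally show ?thesis .
      qed
      moreover have "measure M ?C = (q / (2 * m)) / q ^ n"
        using g q m cyl_measure[of g] by (cases n) (auto simp: n_def field_simps)
      moreover have "?C \<inter> boundary_shift n -` X = ?C" "D \<inter> X = D"
        using boundary_cylinder_append[of g "[]"] sets.sets_into_space[OF D]
        by (auto simp: X True n_def) (auto simp: boundary_cylinder_def D_def)
      ultimately show ?thesis by simp
    next
      case w: False
      consider "\<not> freely_reduced w" | "hd w = letter_inv (last g)"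
        | "freely_reduced w" "hd w \<noteq> letter_inv (last g)" by blast
      then show ?thesis
      proof cases
        case 1
        then show ?thesis by (simp add: X boundary_cylinder_eq_empty)
      next
        case 2
        \<comment> \<open>The first letter of \<open>w\<close> cancels the last letter of
          \<open>g\<close>, so both sides are 0.\<close>
        have "\<not> freely_reduced (g @ w)"
          using 2 w g by (simp add: freely_reduced_def successively_append_iff)
        moreover have "D \<inter> X = {}"
          using 2 w by (auto simp: D_def X boundary_cylinder_def hd_conv_nth)
        ultimately show ?thesis
          using boundary_cylinder_append[of g w] by (simp add: X n_def boundary_cylinder_eq_empty)
      next
        case 3
        have gw: "freely_reduced (g @ w)"
          using 3 w g by (simp add: freely_reduced_def successively_append_iff)
        have "D \<inter> X = X"
          using 3 w by (auto simp: D_def X boundary_cylinder_def hd_conv_nth)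
        moreover have "?C \<inter> boundary_shift n -` X = boundary_cylinder (g @ w)"
          using boundary_cylinder_append[of g w] by (simp add: X n_def)
        \<comment> \<open>As \<open>w\<close> is nonempty, the truncated subtraction is exact and
          the two exponents differ by \<open>n\<close>.\<close>
        moreover have "length (g @ w) - 1 = n + (length w - 1)"
          using w by (cases w) (simp_all add: n_def)
        ultimately show ?thesis
          using cyl_measure[OF gw] cyl_measure[OF 3(1) w] w by (simp add: X power_add)
      qed
    qed
    then show "emeasure ?P X = emeasure ?Q X"
      using P[of X] Q[of X] cyl[of w] by (simp only: X)
  next
    show "sets ?P = sigma_sets free_boundary (range boundary_cylinder)"
      "sets ?Q = sigma_sets free_boundary (range boundary_cylinder)"
      by (simp_all add: sets_uniform_measure[OF M])
    show "range (\<lambda>_. boundary_cylinder []) \<subseteq> range (boundary_cylinder :: 'a letter list \<Rightarrow> _)"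
      by blast
    show "(\<Union>i::nat. boundary_cylinder []) = (free_boundary :: (nat \<Rightarrow> 'a letter) set)"
      by (simp add: boundary_cylinder_def)
    show "emeasure ?P (boundary_cylinder []) \<noteq> \<infinity>"
      by (simp add: P cyl)
  qed
  then have "ennreal (measure M (?C \<inter> boundary_shift n -` E)) = ennreal (measure M (D \<inter> E) / q ^ n)"
    using P[OF E] Q[OF E] by simp
  moreover have "D \<inter> E = {\<xi> \<in> E. \<xi> 0 \<noteq> letter_inv (last g)}"
    using sets.sets_into_space[OF E] by (auto simp: D_def sp)
  ultimately show ?thesis
    using q by (simp add: n_def q_def m_def)
qed

section \<open>Wandering sets\<close>

text \<open>The shift by \<open>length g\<close> maps this part of \<open>N\<close> into the
  preimage of \<open>N\<close> under \<open>g\<close>. The scaling identity applies to that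
  preimage; forgetting its condition on the first letter only enlarges the bound.\<close>

lemma measure_Int_cylinder_le:
  fixes M :: "(nat \<Rightarrow> 'a::finite letter) measure"
  assumes M: "uniform_measure_on_boundary M" and g: "freely_reduced g" "g \<noteq> []"
    and N: "N \<in> sets M"
  shows "measure M (N \<inter> boundary_cylinder g) \<le>
    measure M (boundary_act g -` N \<inter> space M) / (2 * real CARD('a) - 1) ^ length g"
proof -
  interpret prob_space M using M by (simp add: uniform_measure_on_boundary_def)
  let ?T = "boundary_act g -` N \<inter> space M"
  have T: "?T \<in> sets M"
    using measurable_boundary_act[OF M] N by (rule measurable_sets)
  have q: "2 * real CARD('a) - 1 > 0"
    using zero_less_card_finite[where 'a = 'a] by linarith
  have "N \<inter> boundary_cylinder g \<subseteq> boundary_cylinder g \<inter> boundary_shift (length g) -` ?T"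
    using boundary_act_shift[of _ g] boundary_cylinder_subset[of g]
    by (auto simp: boundary_shift_in_boundary subset_iff space_uniform_measure[OF M])
  moreover have "boundary_cylinder g \<inter> boundary_shift (length g) -` ?T \<in> sets M"
  proof -
    have "boundary_cylinder g \<inter> boundary_shift (length g) -` ?T =
        boundary_cylinder g \<inter> (boundary_shift (length g) -` ?T \<inter> space M)"
      using boundary_cylinder_subset by (auto simp: space_uniform_measure[OF M])
    then show ?thesis
      using measurable_sets[OF measurable_boundary_shift[OF M] T] boundary_cylinder_in_sets[OF M]
      by (metis sets.Int)
  qed
  ultimately have "measure M (N \<inter> boundary_cylinder g) \<le>
      measure M (boundary_cylinder g \<inter> boundary_shift (length g) -` ?T)"
    by (rule finite_measure_mono)
  also have "\<dots> = measure M {\<xi> \<in> ?T. \<xi> 0 \<noteq> letter_inv (last g)} / (2 * real CARD('a) - 1) ^ length g"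
    by (rule measure_cylinder_Int_shift[OF M g T])
  also have "\<dots> \<le> measure M ?T / (2 * real CARD('a) - 1) ^ length g"
    using q by (intro divide_right_mono finite_measure_mono T) auto
  finally show ?thesis .
qed

text \<open>Write \<open>g' = h g\<close> with \<open>h\<close> in \<open>H\<close>; then
  \<open>h\<close> is not the identity. If \<open>g\<close> and \<open>g'\<close> both sent
  \<open>\<xi>\<close> into \<open>N\<close>, the image under \<open>g'\<close> would lie in
  \<open>N\<close> and in its translate by \<open>h\<close>.\<close>

lemma disjoint_preimages_of_wandering_set:
  assumes H: "subgroup H free_group"
    and wand: "\<And>h. h \<in> H - {\<one>\<^bsub>free_group\<^esub>} \<Longrightarrow> N \<inter> boundary_act h ` N = {}"
    and g: "g \<in> carrier free_group" "g' \<in> carrier free_group" "g \<noteq> g'"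
    and coset: "H #>\<^bsub>free_group\<^esub> g = H #>\<^bsub>free_group\<^esub> g'"
  shows "boundary_act g -` N \<inter> boundary_act g' -` N \<inter> free_boundary = {}"
proof -
  interpret group free_group by (rule group_free_group)
  have "g' \<in> H #>\<^bsub>free_group\<^esub> g"
    using rcos_self[OF g(2) H] coset by simp
  then obtain h where h: "h \<in> H" "g' = h \<otimes>\<^bsub>free_group\<^esub> g"
    by (auto simp: r_coset_def)
  have hc: "h \<in> carrier free_group" using h(1) subgroup.subset[OF H] by blast
  have "h \<noteq> \<one>\<^bsub>free_group\<^esub>" using h(2) g by auto
  then have disj: "N \<inter> boundary_act h ` N = {}" using wand h(1) by blast
  have "boundary_act g' \<xi> = boundary_act h (boundary_act g \<xi>)" if "\<xi> \<in> free_boundary" for \<xi>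
    using boundary_act_mult[OF hc g(1) that] h(2) by simp
  then show ?thesis using disj by force
qed

lemma measure_wandering_le:
  fixes M :: "(nat \<Rightarrow> 'a::finite letter) measure"
  assumes M: "uniform_measure_on_boundary M" and H: "subgroup H free_group"
    and N: "N \<in> sets M"
    and wand: "\<And>h. h \<in> H - {\<one>\<^bsub>free_group\<^esub>} \<Longrightarrow> N \<inter> boundary_act h ` N = {}"
    and n: "n > 0"
  shows "measure M N \<le> card (graph_ball (schreier_graph H) H n) / (2 * real CARD('a) - 1) ^ n"
proof -
  interpret prob_space M using M by (simp add: uniform_measure_on_boundary_def)
  define q where "q = 2 * real CARD('a) - 1"
  have q: "q > 0"
    unfolding q_def using zero_less_card_finite[where 'a = 'a] by linarith
  define W :: "'a letter list set" where "W = {g \<in> carrier free_group. length g = n}"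
  have finW: "finite W"
    using finite_lists_length_eq[of "UNIV :: 'a letter set" n]
    by (rule finite_subset[rotated]) (auto simp: W_def)
  let ?c = "\<lambda>g. H #>\<^bsub>free_group\<^esub> g"
  let ?T = "\<lambda>g. boundary_act g -` N \<inter> space M"
  have T: "?T g \<in> sets M" for g
    using measurable_boundary_act[OF M] N by (rule measurable_sets)
  have sp: "space M = free_boundary" by (rule space_uniform_measure[OF M])
  \<comment> \<open>Every boundary point lies in the cylinder of its own prefix of length
    \<open>n\<close>, which is reduced.\<close>
  have "N \<subseteq> (\<Union>g\<in>W. N \<inter> boundary_cylinder g)"
  proof
    fix \<xi> assume \<xi>: "\<xi> \<in> N"
    then have b: "\<xi> \<in> free_boundary" using sets.sets_into_space[OF N] sp by auto
    let ?g = "map \<xi> [0..<n]"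
    have "\<xi> \<in> boundary_cylinder ?g" using b by (simp add: boundary_cylinder_def)
    moreover from this have "freely_reduced ?g" using boundary_cylinder_eq_empty by blast
    ultimately show "\<xi> \<in> (\<Union>g\<in>W. N \<inter> boundary_cylinder g)"
      using \<xi> by (auto simp: W_def free_group_def intro!: bexI[of _ ?g])
  qed
  then have "measure M N \<le> measure M (\<Union>g\<in>W. N \<inter> boundary_cylinder g)"
    using N finW boundary_cylinder_in_sets[OF M] by (intro finite_measure_mono) auto
  also have "\<dots> \<le> (\<Sum>g\<in>W. measure M (N \<inter> boundary_cylinder g))"
    using N boundary_cylinder_in_sets[OF M]
    by (intro finite_measure_subadditive_finite finW) auto
  also have "\<dots> \<le> (\<Sum>g\<in>W. measure M (?T g) / q ^ n)"
  proof (rule sum_mono)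
    fix g assume "g \<in> W"
    then show "measure M (N \<inter> boundary_cylinder g) \<le> measure M (?T g) / q ^ n"
      using measure_Int_cylinder_le[OF M _ _ N, of g] n by (auto simp: W_def free_group_def q_def)
  qed
  also have "\<dots> = (\<Sum>x\<in>?c ` W. \<Sum>g | g \<in> W \<and> ?c g = x. measure M (?T g)) / q ^ n"
    by (simp add: sum.image_gen[OF finW, where g = ?c] flip: sum_divide_distrib)
  \<comment> \<open>Within one coset the preimages are disjoint, so their measures sum to at most
    the total mass 1.\<close>
  also have "\<dots> \<le> (\<Sum>x\<in>?c ` W. 1) / q ^ n"
  proof (intro divide_right_mono sum_mono)
    fix x
    let ?F = "{g. g \<in> W \<and> ?c g = x}"
    have "disjoint_family_on ?T ?F"
    proof (unfold disjoint_family_on_def, intro ballI impI)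
      fix g g' assume "g \<in> ?F" "g' \<in> ?F" "g \<noteq> g'"
      then show "?T g \<inter> ?T g' = {}"
        using disjoint_preimages_of_wandering_set[OF H wand, of g g'] by (auto simp: W_def sp)
    qed
    then have "(\<Sum>g\<in>?F. measure M (?T g)) = measure M (\<Union>g\<in>?F. ?T g)"
      using finW T by (intro finite_measure_finite_Union[symmetric]) auto
    then show "(\<Sum>g\<in>?F. measure M (?T g)) \<le> 1"
      by simp
  qed (use q in simp)
  also have "\<dots> \<le> card (graph_ball (schreier_graph H) H n) / q ^ n"
    using card_cosets_of_length_le_graph_ball[OF H, of n] q
    by (intro divide_right_mono) (auto simp: W_def)
  finally show ?thesis by (simp add: q_def)
qed

text \<open>For a real \<open>r\<close> strictly between the growth rate and
  \<open>q = 2m - 1\<close>, the ball bound is eventually at most \<open>(r / q) ^ n\<close>, which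
  tends to 0.\<close>

lemma wandering_set_null:
  fixes M :: "(nat \<Rightarrow> 'a::finite letter) measure"
  assumes M: "uniform_measure_on_boundary M" and H: "subgroup H free_group"
    and growth: "growth_rate (schreier_graph H) H < ereal (2 * real CARD('a) - 1)"
    and N: "N \<in> sets M"
    and wand: "\<And>h. h \<in> H - {\<one>\<^bsub>free_group\<^esub>} \<Longrightarrow> N \<inter> boundary_act h ` N = {}"
  shows "measure M N = 0"
proof -
  define b where "b n = real (card (graph_ball (schreier_graph H) H n))" for n
  define q where "q = 2 * real CARD('a) - 1"
  obtain r where r: "growth_rate (schreier_graph H) H < ereal r" "ereal r < ereal q"
    using ereal_dense2[OF growth] by (auto simp: q_def)
  have "\<forall>\<^sub>F n in sequentially. ereal (root n (b n)) < ereal r"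
    using r(1) unfolding growth_rate_def b_def by (rule Limsup_lessD)
  \<comment> \<open>Positive \<open>n\<close> makes \<open>root n\<close> invert the
    \<open>n\<close>-th power; \<open>root 0\<close> is constantly 0.\<close>
  then have ev: "\<forall>\<^sub>F n in sequentially. n > 0 \<and> root n (b n) < r"
    using eventually_gt_at_top[of 0] by eventually_elim simp
  \<comment> \<open>One index suffices: \<open>r\<close> exceeds a root of a cardinality, hence is
    positive, and so is \<open>q\<close>.\<close>
  then obtain k where "k > 0" "root k (b k) < r"
    using eventually_happens'[OF sequentially_bot] by blast
  moreover have "root k (b k) \<ge> 0"
    by (simp add: b_def real_root_ge_zero)
  ultimately have r0: "r > 0" by linarith
  have "\<forall>\<^sub>F n in sequentially. measure M N \<le> (r / q) ^ n"
    using ev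
  proof eventually_elim
    case (elim n)
    have "b n = root n (b n) ^ n"
      using elim by (simp add: b_def)
    also have "\<dots> \<le> r ^ n"
      using elim by (intro power_mono) (simp_all add: b_def)
    finally have "b n / q ^ n \<le> (r / q) ^ n"
      using r0 r(2) by (simp add: power_divide divide_right_mono)
    moreover have "measure M N \<le> b n / q ^ n"
      using measure_wandering_le[OF M H N wand, of n] elim by (simp add: b_def q_def)
    ultimately show ?case by linarith
  qed
  moreover have "(\<lambda>n. (r / q) ^ n) \<longlonglongrightarrow> 0"
    using r0 r(2) by (intro LIMSEQ_realpow_zero) simp_all
  ultimately have "measure M N \<le> 0"
    by (intro tendsto_lowerbound[of _ _ sequentially]) simp_all
  then show ?thesis
    by (simp add: measure_le_0_iff)
qed

section \<open>Conservativity from the vanishing of wandering sets\<close>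

theorem corollary4p14:
  fixes H :: "'a::finite letter list set"
    and M :: "(nat \<Rightarrow> 'a letter) measure"
  assumes "CARD('a) \<ge> 2"
    and "subgroup H free_group"
    and "H \<noteq> {\<one>\<^bsub>free_group\<^esub>}"
    and "uniform_measure_on_boundary M"
    and "growth_rate (schreier_graph H) H < ereal (2 * real CARD('a) - 1)"
  shows "conservative_action (free_group\<lparr>carrier := H\<rparr>) boundary_act M"
  unfolding conservative_action_def
proof (intro ballI impI)
  fix A assume A: "A \<in> sets M"
  interpret prob_space M using assms(4) by (simp add: uniform_measure_on_boundary_def)
  let ?U = "\<Union>h\<in>H - {\<one>\<^bsub>free_group\<^esub>}. boundary_act h ` A"
  \<comment> \<open>\<open>H\<close> is countable, being a set of words over a finite
    alphabet.\<close>
  have "?U \<in> sets M"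
    using boundary_act_image_in_sets[OF assms(4) _ A] subgroup.subset[OF assms(2)]
    by (intro sets.countable_UN') (auto intro: countableI_type)
  then have N: "A - ?U \<in> sets M" using A by auto
  \<comment> \<open>The non-recurrent part of \<open>A\<close> avoids every translate of
    \<open>A\<close> by a non-identity element of \<open>H\<close>, hence also every such translate
    of itself.\<close>
  have "measure M (A - ?U) = 0"
    by (rule wandering_set_null[OF assms(4,2,5) N]) auto
  then have "A - ?U \<in> null_sets M"
    using N by (simp add: null_sets_def emeasure_eq_measure)
  then show "AE \<xi> in M. \<xi> \<in> A \<longrightarrow>
      \<xi> \<in> (\<Union>h\<in>carrier (free_group\<lparr>carrier := H\<rparr>) - {\<one>\<^bsub>free_group\<lparr>carrier := H\<rparr>\<^esub>}. boundary_act h ` A)"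
    by (rule AE_I') auto
qed

end
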